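(* Let $G$ be a nontrivial finite group with an inverse-closed generating set $C\subseteq G\setminus\{1\}$, and let $\Phi(G)$ be the Frattini subgroup of $G$. Then: (a) $\Phi(G)\leq\Phi(G;C)$; (b) for $N\in\mathcal{A}_{\max}(G;C)$ and $N\leq M<G$ with $M$ a maximal subgroup of $G$, we have $N=\bigcap_{g\in G,\ \sigma\in\mathrm{Aut}(G;C)}(M^g)^\sigma$.
   Context: A subset $C\subseteq G\setminus\{1\}$ is inverse-closed if it is non-empty and $c^{-1}\in C$ for each $c\in C$. $\mathrm{Aut}(G;C)=\{\sigma\in\mathrm{Aut}(G)\mid C^\sigma=C\}$. Define $\mathcal{A}(G;C)=\{N\mid N\unlhd G,\ N\neq G,\ N^\sigma=N\text{ for all }\sigma\in\mathrm{Aut}(G;C)\}$, let $\mathcal{A}_{\max}(G;C)$ be the set of elements of $\mathcal{A}(G;C)$ maximal under inclusion, and $\Phi(G;C)=\bigcap\{N\mid N\in\mathcal{A}_{\max}(G;C)\}$. The Frattini subgroup $\Phi(G)$ is the intersection of all maximal (proper) subgroups of $G$. $M^g=g^{-1}Mg$. *)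

theory Defs
  imports "HOL-Algebra.Algebra"
begin

definition inverse_closed :: "('a, 'b) monoid_scheme \<Rightarrow> 'a set \<Rightarrow> bool" where
  "inverse_closed G C \<longleftrightarrow>
     C \<subseteq> carrier G - {\<one>\<^bsub>G\<^esub>} \<and> C \<noteq> {} \<and> (\<forall>c\<in>C. inv\<^bsub>G\<^esub> c \<in> C)"

definition aut_stab :: "('a, 'b) monoid_scheme \<Rightarrow> 'a set \<Rightarrow> ('a \<Rightarrow> 'a) set" where
  "aut_stab G C = {\<sigma> \<in> auto G. \<sigma> ` C = C}"

definition inv_normals :: "('a, 'b) monoid_scheme \<Rightarrow> 'a set \<Rightarrow> 'a set set" where
  "inv_normals G C =
     {N. N \<lhd> G \<and> N \<noteq> carrier G \<and> (\<forall>\<sigma>\<in>aut_stab G C. \<sigma> ` N = N)}"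

definition max_inv_normals :: "('a, 'b) monoid_scheme \<Rightarrow> 'a set \<Rightarrow> 'a set set" where
  "max_inv_normals G C =
     {N \<in> inv_normals G C. \<forall>K\<in>inv_normals G C. N \<subseteq> K \<longrightarrow> K = N}"

text \<open>In this definition and in \<open>frattini\<close> below, intersecting with the carrier only matters
  for an empty family of subgroups (for finite \<open>G\<close>: only if \<open>G\<close> is trivial), where the result
  is \<open>G\<close> rather than the whole type.\<close>

definition Phi_rel :: "('a, 'b) monoid_scheme \<Rightarrow> 'a set \<Rightarrow> 'a set" where
  "Phi_rel G C = carrier G \<inter> \<Inter>(max_inv_normals G C)"

definition maximal_subgroup :: "'a set \<Rightarrow> ('a, 'b) monoid_scheme \<Rightarrow> bool" where
  "maximal_subgroup M G \<longleftrightarrow>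
     subgroup M G \<and> M \<noteq> carrier G \<and>
     (\<forall>H. subgroup H G \<and> M \<subseteq> H \<longrightarrow> H = M \<or> H = carrier G)"

definition frattini :: "('a, 'b) monoid_scheme \<Rightarrow> 'a set" where
  "frattini G = carrier G \<inter> \<Inter>{M. maximal_subgroup M G}"

definition conj_set :: "('a, 'b) monoid_scheme \<Rightarrow> 'a set \<Rightarrow> 'a \<Rightarrow> 'a set" where
  "conj_set G M g = (\<lambda>x. inv\<^bsub>G\<^esub> g \<otimes>\<^bsub>G\<^esub> x \<otimes>\<^bsub>G\<^esub> g) ` M"

text \<open>Both \<open>\<Phi>(G)\<close> and \<open>\<Phi>(G;C)\<close> are subgroups of \<open>G\<close>, so \<open>\<Phi>(G) \<le> \<Phi>(G;C)\<close> is inclusion of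
  carriers.\<close>

lemma (in group) subgroup_frattini: "subgroup (frattini G) G"
proof -
  have "frattini G = \<Inter>(insert (carrier G) {M. maximal_subgroup M G})"
    by (simp add: frattini_def)
  moreover have "subgroup \<dots> G"
    by (rule subgroups_Inter) (auto simp: maximal_subgroup_def subgroup_self)
  ultimately show ?thesis by simp
qed

lemma (in group) subgroup_Phi_rel: "subgroup (Phi_rel G C) G"
proof -
  have "Phi_rel G C = \<Inter>(insert (carrier G) (max_inv_normals G C))"
    by (simp add: Phi_rel_def)
  moreover have "subgroup \<dots> G"
    by (rule subgroups_Inter)
      (auto simp: max_inv_normals_def inv_normals_def subgroup_self normal_imp_subgroup)
  ultimately show ?thesis by simp
qed

end

theory Submission
  imports Defs
begin

text \<open>Since \<open>Aut(G;C)\<close> is closed under inverses, the intersection of the sets \<open>(M\<^sup>g)\<^sup>\<sigma>\<close> consists of the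
  \<open>x\<close> with \<open>g x\<^sup>\<sigma> g\<inverse> \<in> M\<close> for all \<open>g\<close> and \<open>\<sigma>\<close>. It is a normal \<open>Aut(G;C)\<close>-invariant subgroup of \<open>M\<close>
  containing every such subgroup of \<open>M\<close>, so it equals \<open>N\<close> by maximality of \<open>N\<close>. As the Frattini
  subgroup is characteristic and contained in \<open>M\<close>, it lies in this intersection, and in the finite
  group \<open>G\<close> every member of \<open>A\<^sub>m\<^sub>a\<^sub>x(G;C)\<close> lies below some maximal subgroup \<open>M\<close>.\<close>

section \<open>Automorphisms: inverses, composition and conjugation\<close>

lemma autoD:
  assumes "f \<in> auto G"
  shows "f \<in> hom G G" "f ` carrier G = carrier G" "inj_on f (carrier G)"
  using assms by (auto simp: auto_def Bij_def bij_betw_def)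

context group
begin

text \<open>Once \<open>m_assoc\<close> has moved all brackets to the right, an element and its
  inverse meet only in these nested forms.\<close>

lemma mult_inv_cancel:
  assumes "x \<in> carrier G" "y \<in> carrier G"
  shows "x \<otimes> (inv x \<otimes> y) = y" "inv x \<otimes> (x \<otimes> y) = y"
  using assms by (simp_all flip: m_assoc)

lemma auto_inverse:
  assumes "f \<in> auto G"
  obtains f' where "f' \<in> auto G" "\<And>x. x \<in> carrier G \<Longrightarrow> f' (f x) = x"
    "\<And>x. x \<in> carrier G \<Longrightarrow> f (f' x) = x"
proof
  note f = autoD[OF assms]
  \<comment> \<open>Members of \<open>auto G\<close> are extensional, so the inverse has to be
    restricted to the carrier.\<close>
  let ?f' = "\<lambda>x\<in>carrier G. inv_into (carrier G) f x"
  show "?f' \<in> auto G"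
    using assms by (simp del: restrict_apply add: auto_def restrict_inv_into_Bij restrict_inv_into_hom)
  show "?f' (f x) = x" if "x \<in> carrier G" for x
    using f that by (auto simp: hom_in_carrier)
  show "f (?f' x) = x" if "x \<in> carrier G" for x
    using f(2) that by (simp add: f_inv_into_f)
qed

lemma auto_compose:
  assumes "f \<in> auto G" "h \<in> auto G"
  shows "compose (carrier G) f h \<in> auto G"
  using assms by (auto simp: auto_def compose_Bij Bij_imp_funcset intro: hom_compose)

text \<open>With inner automorphisms in \<open>auto G\<close>, invariance under automorphisms also
  covers conjugation.\<close>

lemma conj_auto:
  assumes g: "g \<in> carrier G"
  shows "(\<lambda>x\<in>carrier G. g \<otimes> x \<otimes> inv g) \<in> auto G"
proof -
  let ?c = "\<lambda>x\<in>carrier G. g \<otimes> x \<otimes> inv g"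
  have "?c \<in> hom G G"
    using g by (auto simp: hom_def m_assoc mult_inv_cancel)
  moreover have "bij_betw ?c (carrier G) (carrier G)"
    by (rule bij_betw_byWitness[where f' = "\<lambda>x. inv g \<otimes> x \<otimes> g"])
      (use g in \<open>auto simp: m_assoc mult_inv_cancel\<close>)
  ultimately show ?thesis
    by (simp add: auto_def Bij_def)
qed

section \<open>Maximal subgroups and the Frattini subgroup under automorphisms\<close>

lemma subgroup_auto_image:
  assumes "f \<in> auto G" "subgroup H G"
  shows "subgroup (f ` H) G"
proof -
  interpret group_hom G G f
    using autoD(1)[OF assms(1)] by unfold_locales
  show ?thesis
    by (rule subgroup_img_is_subgroup[OF assms(2)])
qed

text \<open>Taking images under \<open>f\<close> and under its inverse \<open>f'\<close> gives
  mutually inverse, inclusion-preserving maps on subgroups.\<close>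

lemma maximal_subgroup_auto_image:
  assumes f: "f \<in> auto G" and M: "maximal_subgroup M G"
  shows "maximal_subgroup (f ` M) G"
proof -
  obtain f' where f': "f' \<in> auto G" "\<And>x. x \<in> carrier G \<Longrightarrow> f' (f x) = x"
    "\<And>x. x \<in> carrier G \<Longrightarrow> f (f' x) = x"
    using auto_inverse[OF f] by blast
  have sub: "subgroup M G" and ne: "M \<noteq> carrier G"
    and max: "\<And>H. subgroup H G \<Longrightarrow> M \<subseteq> H \<Longrightarrow> H = M \<or> H = carrier G"
    using M by (auto simp: maximal_subgroup_def)
  \<comment> \<open>The two maps are known to cancel only on the carrier, hence the restriction on
    \<open>A\<close>.\<close>
  have f'f: "f' ` f ` A = A" and ff': "f ` f' ` A = A" if "A \<subseteq> carrier G" for A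
    using image_cong[of A A "\<lambda>x. f' (f x)" "\<lambda>x. x"] image_cong[of A A "\<lambda>x. f (f' x)" "\<lambda>x. x"]
      that f'(2,3) by (simp_all add: image_image subset_iff)
  note MG = subgroup.subset[OF sub]
  show ?thesis
    unfolding maximal_subgroup_def
  proof (intro conjI allI impI)
    show "subgroup (f ` M) G"
      using f sub by (rule subgroup_auto_image)
    show "f ` M \<noteq> carrier G"
      using f'f[OF MG] autoD(2)[OF f'(1)] ne by metis
    fix H assume H: "subgroup H G \<and> f ` M \<subseteq> H"
    \<comment> \<open>Pulling \<open>H\<close> back along \<open>f'\<close> gives a subgroup above
      \<open>M\<close>, to which the maximality of \<open>M\<close> applies.\<close>
    have "M \<subseteq> f' ` H"
      using H f'f[OF MG] by blast
    then have "f' ` H = M \<or> f' ` H = carrier G"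
      using max subgroup_auto_image f'(1) H by blast
    then show "H = f ` M \<or> H = carrier G"
      using ff'[of H] subgroup.subset[of H G] H autoD(2)[OF f] by auto
  qed
qed

text \<open>For maximal \<open>M\<close> the image of \<open>M\<close> under the inverse
  \<open>f'\<close> is again maximal, so it contains \<open>x\<close>; applying \<open>f\<close>
  puts \<open>f x\<close> into \<open>M\<close>.\<close>

lemma frattini_characteristic:
  assumes f: "f \<in> auto G" and x: "x \<in> frattini G"
  shows "f x \<in> frattini G"
proof -
  obtain f' where f': "f' \<in> auto G" "\<And>x. x \<in> carrier G \<Longrightarrow> f' (f x) = x"
    "\<And>x. x \<in> carrier G \<Longrightarrow> f (f' x) = x"
    using auto_inverse[OF f] by blast
  have "f x \<in> M" if M: "maximal_subgroup M G" for M
  proof -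
    have "x \<in> f' ` M"
      using x maximal_subgroup_auto_image[OF f'(1) M] by (auto simp: frattini_def)
    moreover have "M \<subseteq> carrier G"
      using M by (simp add: maximal_subgroup_def subgroup.subset)
    ultimately show ?thesis
      using f'(3) by auto
  qed
  moreover have "f x \<in> carrier G"
    using x autoD(1)[OF f] by (auto simp: frattini_def hom_in_carrier)
  ultimately show ?thesis
    by (simp add: frattini_def)
qed

text \<open>Finiteness enters here: the proper subgroups form a finite set, which has a maximal
  element above \<open>H\<close>.\<close>

lemma ex_maximal_subgroup:
  assumes "finite (carrier G)" "subgroup H G" "H \<noteq> carrier G"
  obtains M where "maximal_subgroup M G" "H \<subseteq> M"
proof -
  let ?S = "{K. subgroup K G \<and> K \<noteq> carrier G}"
  have "finite ?S"
    by (rule finite_subset[of _ "Pow (carrier G)"]) (auto simp: assms(1) dest: subgroup.subset)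
  then obtain M where "M \<in> ?S" "H \<subseteq> M" "\<forall>K\<in>?S. M \<subseteq> K \<longrightarrow> M = K"
    using finite_has_maximal2[of ?S H] assms by auto
  then show thesis
    by (intro that[of M]) (auto simp: maximal_subgroup_def)
qed

section \<open>Group operations in Aut(G;C)\<close>

lemma id_in_aut_stab:
  assumes "C \<subseteq> carrier G"
  shows "(\<lambda>x\<in>carrier G. x) \<in> aut_stab G C"
  using assms id_in_auto by (force simp: aut_stab_def)

lemma aut_stab_compose:
  assumes "C \<subseteq> carrier G" "\<sigma> \<in> aut_stab G C" "\<tau> \<in> aut_stab G C"
  shows "compose (carrier G) \<sigma> \<tau> \<in> aut_stab G C"
proof -
  have "compose (carrier G) \<sigma> \<tau> ` C = \<sigma> ` \<tau> ` C"
    using assms(1) by (force simp: compose_def)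
  then show ?thesis
    using assms(2,3) by (simp add: aut_stab_def auto_compose)
qed

lemma aut_stab_inverse:
  assumes "C \<subseteq> carrier G" "\<sigma> \<in> aut_stab G C"
  obtains \<sigma>' where "\<sigma>' \<in> aut_stab G C" "\<And>x. x \<in> carrier G \<Longrightarrow> \<sigma>' (\<sigma> x) = x"
    "\<And>x. x \<in> carrier G \<Longrightarrow> \<sigma> (\<sigma>' x) = x"
proof -
  have \<sigma>: "\<sigma> \<in> auto G" "\<sigma> ` C = C"
    using assms(2) by (auto simp: aut_stab_def)
  obtain \<sigma>' where \<sigma>': "\<sigma>' \<in> auto G" "\<And>x. x \<in> carrier G \<Longrightarrow> \<sigma>' (\<sigma> x) = x"
    "\<And>x. x \<in> carrier G \<Longrightarrow> \<sigma> (\<sigma>' x) = x"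
    using auto_inverse[OF \<sigma>(1)] by blast
  \<comment> \<open>As \<sigma> maps \<open>C\<close> onto itself, this says that \<sigma>' does so
    too.\<close>
  have "\<sigma>' ` \<sigma> ` C = C"
    using image_cong[of C C "\<lambda>x. \<sigma>' (\<sigma> x)" "\<lambda>x. x"] assms(1) \<sigma>'(2)
    by (simp add: image_image subset_iff)
  then show thesis
    using that \<sigma>' \<sigma>(2) by (simp add: aut_stab_def)
qed

text \<open>An analogue of the normal core that also takes Aut(G;C) into account. The pointwise
  form, with \<sigma> applied to \<open>x\<close> instead of an image of \<open>M\<close>, lets
  closure properties follow from the homomorphism laws.\<close>

definition aut_core :: "'a set \<Rightarrow> 'a set \<Rightarrow> 'a set" where
  "aut_core C M =
    {x \<in> carrier G. \<forall>g\<in>carrier G. \<forall>\<sigma>\<in>aut_stab G C. g \<otimes> \<sigma> x \<otimes> inv g \<in> M}"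

section \<open>The core as an intersection of images of conjugates\<close>

lemma mem_conj_set_iff:
  assumes "M \<subseteq> carrier G" "g \<in> carrier G" "y \<in> carrier G"
  shows "y \<in> conj_set G M g \<longleftrightarrow> g \<otimes> y \<otimes> inv g \<in> M"
proof
  assume "y \<in> conj_set G M g"
  then show "g \<otimes> y \<otimes> inv g \<in> M"
    using assms by (auto simp: conj_set_def m_assoc mult_inv_cancel subset_iff)
next
  assume *: "g \<otimes> y \<otimes> inv g \<in> M"
  have "y = inv g \<otimes> (g \<otimes> y \<otimes> inv g) \<otimes> g"
    using assms by (simp add: m_assoc mult_inv_cancel)
  then show "y \<in> conj_set G M g"
    using * unfolding conj_set_def by blast
qed

lemma mem_aut_image_conj_set_iff:
  assumes "\<sigma> \<in> aut_stab G C" "M \<subseteq> carrier G" "g \<in> carrier G"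
    and \<tau>: "\<tau> \<in> aut_stab G C" "\<And>x. x \<in> carrier G \<Longrightarrow> \<tau> (\<sigma> x) = x"
      "\<And>x. x \<in> carrier G \<Longrightarrow> \<sigma> (\<tau> x) = x"
    and x: "x \<in> carrier G"
  shows "x \<in> \<sigma> ` conj_set G M g \<longleftrightarrow> g \<otimes> \<tau> x \<otimes> inv g \<in> M"
proof -
  have sub: "conj_set G M g \<subseteq> carrier G"
    using assms(2,3) by (auto simp: conj_set_def)
  have \<tau>x: "\<tau> x \<in> carrier G"
    using \<tau>(1) x by (auto simp: aut_stab_def dest!: autoD(1) intro: hom_in_carrier)
  have "x \<in> \<sigma> ` conj_set G M g \<longleftrightarrow> \<tau> x \<in> conj_set G M g"
  proof
    assume "x \<in> \<sigma> ` conj_set G M g"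
    then obtain y where "y \<in> conj_set G M g" "x = \<sigma> y" by (rule imageE)
    then show "\<tau> x \<in> conj_set G M g"
      using sub \<tau>(2)[of y] by (simp add: subset_iff)
  next
    assume "\<tau> x \<in> conj_set G M g"
    then show "x \<in> \<sigma> ` conj_set G M g"
      using \<tau>(3)[OF x] by (intro image_eqI[of _ _ "\<tau> x"]) simp_all
  qed
  then show ?thesis
    using mem_conj_set_iff assms(2,3) \<tau>x by simp
qed

text \<open>Membership in the image under \<sigma> is tested by applying the inverse of \<sigma>.
  Inversion permutes Aut(G;C), so testing all inverses is the same as testing all
  automorphisms.\<close>

lemma aut_core_eq_Inter:
  assumes C: "C \<subseteq> carrier G" and M: "M \<subseteq> carrier G"
  shows "aut_core C M = (\<Inter>g\<in>carrier G. \<Inter>\<sigma>\<in>aut_stab G C. \<sigma> ` conj_set G M g)"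
    (is "_ = ?R")
proof (intro equalityI subsetI)
  fix x assume x: "x \<in> aut_core C M"
  show "x \<in> ?R"
  proof (intro INT_I)
    fix g \<sigma> assume g: "g \<in> carrier G" and \<sigma>: "\<sigma> \<in> aut_stab G C"
    obtain \<tau> where \<tau>: "\<tau> \<in> aut_stab G C" "\<And>x. x \<in> carrier G \<Longrightarrow> \<tau> (\<sigma> x) = x"
      "\<And>x. x \<in> carrier G \<Longrightarrow> \<sigma> (\<tau> x) = x"
      using aut_stab_inverse[OF C \<sigma>] by blast
    then show "x \<in> \<sigma> ` conj_set G M g"
      using mem_aut_image_conj_set_iff[OF \<sigma> M g \<tau>] x g by (simp add: aut_core_def)
  qed
next
  fix x assume x: "x \<in> ?R"
  \<comment> \<open>The index pair of \<one> and the identity shows that \<open>x\<close> lies in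
    the carrier, as the membership test requires.\<close>
  have "x \<in> (\<lambda>x\<in>carrier G. x) ` conj_set G M \<one>"
    using x id_in_aut_stab[OF C] by blast
  then have xG: "x \<in> carrier G"
    using M by (auto simp: conj_set_def)
  have "g \<otimes> \<tau> x \<otimes> inv g \<in> M" if g: "g \<in> carrier G" and \<tau>: "\<tau> \<in> aut_stab G C" for g \<tau>
  proof -
    \<comment> \<open>The condition at \<tau> is read off from the set indexed by the inverse of
      \<tau>.\<close>
    obtain \<sigma> where \<sigma>: "\<sigma> \<in> aut_stab G C" "\<And>x. x \<in> carrier G \<Longrightarrow> \<sigma> (\<tau> x) = x"
      "\<And>x. x \<in> carrier G \<Longrightarrow> \<tau> (\<sigma> x) = x"
      using aut_stab_inverse[OF C \<tau>] by blast
    then show ?thesis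
      using mem_aut_image_conj_set_iff[OF \<sigma>(1) M g \<tau> \<sigma>(3,2) xG] x g by blast
  qed
  with xG show "x \<in> aut_core C M"
    by (simp add: aut_core_def)
qed

section \<open>The core as an invariant normal subgroup\<close>

lemma aut_core_subset:
  assumes "C \<subseteq> carrier G"
  shows "aut_core C M \<subseteq> M"
proof
  fix x assume x: "x \<in> aut_core C M"
  then have "\<one> \<otimes> (\<lambda>x\<in>carrier G. x) x \<otimes> inv \<one> \<in> M"
    using id_in_aut_stab[OF assms] unfolding aut_core_def by blast
  with x show "x \<in> M"
    by (simp add: aut_core_def)
qed

text \<open>Each map \<open>x \<mapsto> g \<otimes> \<sigma> x \<otimes> inv g\<close> is a
  homomorphism, so the core is an intersection of preimages of \<open>M\<close>.\<close>

lemma aut_core_normal: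
  assumes M: "subgroup M G"
  shows "aut_core C M \<lhd> G"
proof -
  interpret M: subgroup M G by fact
  have gh: "group_hom G G \<sigma>" if "\<sigma> \<in> aut_stab G C" for \<sigma>
    using that autoD(1) by (unfold_locales) (auto simp: aut_stab_def)
  have "subgroup (aut_core C M) G"
  proof (rule subgroupI)
    show "aut_core C M \<subseteq> carrier G"
      by (auto simp: aut_core_def)
    have "\<one> \<in> aut_core C M"
      by (simp add: aut_core_def group_hom.hom_one[OF gh])
    then show "aut_core C M \<noteq> {}" by blast
  next
    fix x assume x: "x \<in> aut_core C M"
    then have xG: "x \<in> carrier G" by (simp add: aut_core_def)
    have "g \<otimes> \<sigma> (inv x) \<otimes> inv g \<in> M" if g: "g \<in> carrier G" and \<sigma>: "\<sigma> \<in> aut_stab G C" for g \<sigma>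
    proof -
      interpret group_hom G G \<sigma> by (rule gh[OF \<sigma>])
      have "g \<otimes> \<sigma> (inv x) \<otimes> inv g = inv (g \<otimes> \<sigma> x \<otimes> inv g)"
        using g xG by (simp add: inv_mult_group m_assoc)
      then show ?thesis
        using x g \<sigma> by (simp add: aut_core_def)
    qed
    then show "inv x \<in> aut_core C M"
      using xG by (simp add: aut_core_def)
  next
    fix x y assume x: "x \<in> aut_core C M" and y: "y \<in> aut_core C M"
    then have xG: "x \<in> carrier G" and yG: "y \<in> carrier G" by (simp_all add: aut_core_def)
    have "g \<otimes> \<sigma> (x \<otimes> y) \<otimes> inv g \<in> M" if g: "g \<in> carrier G" and \<sigma>: "\<sigma> \<in> aut_stab G C" for g \<sigma>
    proof -
      interpret group_hom G G \<sigma> by (rule gh[OF \<sigma>])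
      have "g \<otimes> \<sigma> (x \<otimes> y) \<otimes> inv g = (g \<otimes> \<sigma> x \<otimes> inv g) \<otimes> (g \<otimes> \<sigma> y \<otimes> inv g)"
        using g xG yG by (simp add: m_assoc mult_inv_cancel)
      then show ?thesis
        using x y g \<sigma> by (simp add: aut_core_def)
    qed
    then show "x \<otimes> y \<in> aut_core C M"
      using xG yG by (simp add: aut_core_def)
  qed
  moreover have "h \<otimes> x \<otimes> inv h \<in> aut_core C M" if h: "h \<in> carrier G" and x: "x \<in> aut_core C M" for h x
  proof -
    have xG: "x \<in> carrier G" using x by (simp add: aut_core_def)
    have "g \<otimes> \<sigma> (h \<otimes> x \<otimes> inv h) \<otimes> inv g \<in> M"
      if g: "g \<in> carrier G" and \<sigma>: "\<sigma> \<in> aut_stab G C" for g \<sigma>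
    proof -
      interpret group_hom G G \<sigma> by (rule gh[OF \<sigma>])
      \<comment> \<open>Conjugating \<open>x\<close> by \<open>h\<close> only replaces the index
        \<open>g\<close> by \<open>g \<otimes> \<sigma> h\<close>.\<close>
      have "g \<otimes> \<sigma> (h \<otimes> x \<otimes> inv h) \<otimes> inv g = (g \<otimes> \<sigma> h) \<otimes> \<sigma> x \<otimes> inv (g \<otimes> \<sigma> h)"
        using g h xG by (simp add: m_assoc inv_mult_group)
      then show ?thesis
        using x g h \<sigma> by (simp add: aut_core_def)
    qed
    then show ?thesis
      using h xG by (simp add: aut_core_def)
  qed
  ultimately show ?thesis
    by (simp add: normal_inv_iff)
qed

lemma aut_core_invariant:
  assumes C: "C \<subseteq> carrier G" and \<tau>: "\<tau> \<in> aut_stab G C"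
  shows "\<tau> ` aut_core C M = aut_core C M"
proof -
  \<comment> \<open>Applying \<sigma> to \<open>x\<close> only replaces the index \<rho> by its
    composite with \<sigma>.\<close>
  have closed: "\<sigma> x \<in> aut_core C M" if \<sigma>: "\<sigma> \<in> aut_stab G C" and x: "x \<in> aut_core C M" for \<sigma> x
  proof -
    have xG: "x \<in> carrier G" using x by (simp add: aut_core_def)
    have "\<sigma> x \<in> carrier G"
      using \<sigma> xG by (auto simp: aut_stab_def dest!: autoD(1) intro: hom_in_carrier)
    moreover have "g \<otimes> \<rho> (\<sigma> x) \<otimes> inv g \<in> M"
      if "g \<in> carrier G" "\<rho> \<in> aut_stab G C" for g \<rho>
    proof -
      have "g \<otimes> compose (carrier G) \<rho> \<sigma> x \<otimes> inv g \<in> M"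
        using x that aut_stab_compose[OF C that(2) \<sigma>] unfolding aut_core_def by blast
      then show ?thesis
        using xG by (simp add: compose_eq)
    qed
    ultimately show ?thesis
      by (simp add: aut_core_def)
  qed
  obtain \<tau>' where "\<tau>' \<in> aut_stab G C" "\<And>x. x \<in> carrier G \<Longrightarrow> \<tau>' (\<tau> x) = x"
    "\<And>x. x \<in> carrier G \<Longrightarrow> \<tau> (\<tau>' x) = x"
    using aut_stab_inverse[OF C \<tau>] by blast
  \<comment> \<open>The reverse inclusion uses the preimage \<open>\<tau>' x\<close>, which
    \<open>closed\<close> puts into the core.\<close>
  then have "x \<in> \<tau> ` aut_core C M" if "x \<in> aut_core C M" for x
    using that closed[of \<tau>' x] by (intro image_eqI[of _ _ "\<tau>' x"]) (simp_all add: aut_core_def)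
  with closed[OF \<tau>] show ?thesis by blast
qed

section \<open>Comparing the core with \<open>N\<close> and with the Frattini subgroup\<close>

lemma inv_normal_subset_aut_core:
  assumes N: "N \<in> inv_normals G C" and "N \<subseteq> M"
  shows "N \<subseteq> aut_core C M"
proof
  fix x assume x: "x \<in> N"
  have norm: "N \<lhd> G" and inv: "\<And>\<sigma>. \<sigma> \<in> aut_stab G C \<Longrightarrow> \<sigma> ` N = N"
    using N by (auto simp: inv_normals_def)
  have "g \<otimes> \<sigma> x \<otimes> inv g \<in> M" if "g \<in> carrier G" "\<sigma> \<in> aut_stab G C" for g \<sigma>
  proof -
    have "\<sigma> x \<in> N"
      using x inv that(2) by blast
    then show ?thesis
      using normal.inv_op_closed2[OF norm that(1)] assms(2) by blast
  qed
  moreover have "x \<in> carrier G"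
    using x norm normal_imp_subgroup subgroup.subset by blast
  ultimately show "x \<in> aut_core C M"
    by (simp add: aut_core_def)
qed

text \<open>The core lies in \<open>M\<close> and so is proper; hence it is a member of
  \<open>inv_normals G C\<close> above \<open>N\<close>, and the maximality of \<open>N\<close>
  forces equality.\<close>

lemma max_inv_normal_eq_aut_core:
  assumes C: "C \<subseteq> carrier G" and N: "N \<in> max_inv_normals G C"
    and NM: "N \<subseteq> M" and M: "maximal_subgroup M G"
  shows "N = aut_core C M"
proof -
  have sub: "subgroup M G" and ne: "M \<noteq> carrier G"
    using M by (auto simp: maximal_subgroup_def)
  have "aut_core C M \<noteq> carrier G"
    using aut_core_subset[OF C, of M] ne subgroup.subset[OF sub] by blast
  then have "aut_core C M \<in> inv_normals G C"
    using aut_core_normal[OF sub] aut_core_invariant[OF C] by (simp add: inv_normals_def)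
  moreover have "N \<subseteq> aut_core C M"
    using N NM inv_normal_subset_aut_core by (simp add: max_inv_normals_def)
  ultimately show ?thesis
    using N by (auto simp: max_inv_normals_def)
qed

text \<open>Applying \<sigma> and then conjugating by \<open>g\<close> are two automorphisms, so
  \<open>x\<close> stays in the Frattini subgroup and therefore in \<open>M\<close>.\<close>

lemma frattini_subset_aut_core:
  assumes M: "maximal_subgroup M G"
  shows "frattini G \<subseteq> aut_core C M"
proof
  fix x assume x: "x \<in> frattini G"
  have "g \<otimes> \<sigma> x \<otimes> inv g \<in> M" if g: "g \<in> carrier G" and \<sigma>: "\<sigma> \<in> aut_stab G C" for g \<sigma>
  proof -
    have "\<sigma> x \<in> frattini G"
      using frattini_characteristic[OF _ x] \<sigma> by (simp add: aut_stab_def)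
    then have "(\<lambda>x\<in>carrier G. g \<otimes> x \<otimes> inv g) (\<sigma> x) \<in> frattini G" "\<sigma> x \<in> carrier G"
      using frattini_characteristic[OF conj_auto[OF g]] by (blast, simp add: frattini_def)
    then show ?thesis
      using M by (simp add: frattini_def)
  qed
  then show "x \<in> aut_core C M"
    using x by (simp add: aut_core_def frattini_def)
qed

text \<open>Each \<open>N\<close> in the intersection is the core of some maximal subgroup above it,
  and every such core contains the Frattini subgroup.\<close>

lemma frattini_subset_Phi_rel:
  assumes fin: "finite (carrier G)" and C: "C \<subseteq> carrier G"
  shows "frattini G \<subseteq> Phi_rel G C"
proof -
  have "frattini G \<subseteq> N" if N: "N \<in> max_inv_normals G C" for N
  proof -
    have "subgroup N G" "N \<noteq> carrier G"
      using N by (auto simp: max_inv_normals_def inv_normals_def normal_imp_subgroup)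
    then obtain M where "maximal_subgroup M G" "N \<subseteq> M"
      using ex_maximal_subgroup[OF fin] by blast
    then show ?thesis
      using frattini_subset_aut_core max_inv_normal_eq_aut_core[OF C N] by blast
  qed
  then show ?thesis
    by (auto simp: Phi_rel_def frattini_def)
qed

end

theorem lemma2p1:
  fixes G :: "('a, 'b) monoid_scheme" and C :: "'a set"
  assumes "group G"
    and "finite (carrier G)"
    and "carrier G \<noteq> {\<one>\<^bsub>G\<^esub>}"
    and "inverse_closed G C"
    and "generate G C = carrier G"
  shows "frattini G \<subseteq> Phi_rel G C \<and>
    (\<forall>N M. N \<in> max_inv_normals G C \<and> N \<subseteq> M \<and> maximal_subgroup M G \<longrightarrow>
      N = (\<Inter>g\<in>carrier G. \<Inter>\<sigma>\<in>aut_stab G C. \<sigma> ` conj_set G M g))"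
proof -
  interpret group G by fact
  have C: "C \<subseteq> carrier G"
    using assms(4) by (auto simp: inverse_closed_def)
  have "N = (\<Inter>g\<in>carrier G. \<Inter>\<sigma>\<in>aut_stab G C. \<sigma> ` conj_set G M g)"
    if "N \<in> max_inv_normals G C" "N \<subseteq> M" and M: "maximal_subgroup M G" for N M
  proof -
    have "M \<subseteq> carrier G"
      using M by (simp add: maximal_subgroup_def subgroup.subset)
    \<comment> \<open>The core of \<open>M\<close> is the link: maximality identifies it with
      \<open>N\<close>, reindexing with the intersection.\<close>
    then show ?thesis
      using max_inv_normal_eq_aut_core[OF C that] aut_core_eq_Inter[OF C] by simp
  qed
  with frattini_subset_Phi_rel[OF assms(2) C] show ?thesis
    by blast
qed

end
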